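(* Let $\mathbb{X}\subset\mathbb{R}^{d}$ be a nonempty closed subset with reach $\tau\in(0,\infty)$ and let $\mathcal{X}\subset\mathbb{R}^{d}$ be a closed discrete set of points. Let $r=\{r_{x}>0:x\in\mathcal{X}\}$ be a set of radii with $r_{\min}:=\min_{x\in\mathcal{X}}r_{x}$ and $r_{\max}:=\max_{x\in\mathcal{X}}r_{x}$, and let $\epsilon:=\max\{d_{\mathbb{X}}(x):x\in\mathcal{X}\}$. Let $\delta>0$ and suppose that $$\mathbb{X}\subset\bigcup_{x\in\mathcal{X}}\mathbb{B}_{\mathbb{R}^d}(x,\delta),\qquad r_{\max}\le\tau-\epsilon .$$ Define $$\tilde{l}:=\tfrac{1}{2}\left(r_{\min}-\tau+\sqrt{(\tau-\epsilon)^{2}-r_{\max}^{2}}-\delta\right),\qquad \epsilon_{\tilde{l}}:=\tau-\sqrt{(\tau-\epsilon)^{2}-r_{\max}^{2}}+\tilde{l},$$ $$\tilde{r}_{\delta,c}^{2}:=\min\left\{\delta^{2}+\epsilon(2\tau-\epsilon),\ \tfrac{1}{2}\left(r_{\max}^{2}-\tilde{l}^{2}+\epsilon(2\tau-\epsilon)+\epsilon_{\tilde{l}}(2\tau-\epsilon_{\tilde{l}})\right)\right\},$$ $$r_{\min}'':=\sqrt{\tau^{2}-\epsilon(2\tau-\epsilon)-\frac{(2\tau^{2}-r_{\min}^{2}-\epsilon(2\tau-\epsilon))^{2}}{4\tau^{2}}},$$ $$\tilde{r}_{b}^{2}:=\frac{2\tau\left((r_{\min}'')^{2}+\epsilon(2\tau-\epsilon)\right)}{\tau+\sqrt{\tau^{2}-\left((r_{\min}'')^{2}+\epsilon(2\tau-\epsilon)\right)}},\qquad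 \tilde{r}_{\delta,b}^{2}:=\min\left\{\delta^{2}+\epsilon(2\tau-\epsilon),\ \tfrac{1}{2}\tilde{r}_{b}^{2}\right\}.$$ Suppose that $\delta$ satisfies the two conditions $$\delta+\sqrt{r_{\max}^{2}-\tilde{l}^{2}+\epsilon(2\tau-\epsilon)-\left((\tau-\epsilon)^{2}-r_{\max}^{2}+\tilde{l}^{2}+(\tau-\epsilon_{\tilde{l}})^{2}\right)\left(\frac{\tau}{\sqrt{\tau^{2}-\tilde{r}_{\delta,c}^{2}}}-1\right)}\le r_{\min},$$ $$\sqrt{\frac{d}{2(d+1)}}\,\frac{r_{\max}}{r_{\min}}\left(\sqrt{\tilde{r}_{b}^{2}-(2\tau^{2}-\tilde{r}_{b}^{2})\left(\frac{\tau}{\sqrt{\tau^{2}-\tilde{r}_{\delta,b}^{2}}}-1\right)}+2\delta\right)\le r_{\min}'' .$$ Then $\mathbb{X}$ is homotopy equivalent to the ambient Čech complex $\mathrm{\check{C}ech}_{\mathbb{R}^{d}}(\mathcal{X},r)$.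
   Context: $\|\cdot\|$ is the Euclidean norm, $d_{\mathbb{X}}(x)=\inf_{y\in\mathbb{X}}\|x-y\|$, and $\mathbb{B}_{\mathbb{R}^d}(x,\rho)=\{y\in\mathbb{R}^d:\|x-y\|<\rho\}$. For closed $\mathbb{X}$, $\mathrm{Med}(\mathbb{X})=\{x\in\mathbb{R}^d\setminus\mathbb{X}: \exists\, q_1\ne q_2\in\mathbb{X},\ \|q_1-x\|=\|q_2-x\|=d_{\mathbb{X}}(x)\}$, and the reach is $\tau_{\mathbb{X}}=\inf\{\|q-x\|: q\in\mathbb{X},\ x\in\mathrm{Med}(\mathbb{X})\}$. $\mathrm{\check{C}ech}_{\mathbb{R}^d}(\mathcal{X},r)$ is the abstract simplicial complex of nonempty finite $\sigma\subset\mathcal{X}$ with $\bigcap_{x\in\sigma}\mathbb{B}_{\mathbb{R}^d}(x,r_x)\ne\emptyset$; homotopy statements refer to its geometric realization. The minima and maxima defining $r_{\min},r_{\max},\epsilon$ are assumed to exist. The conditions on $\delta$ are understood to include that all expressions occurring are well defined (arguments of square roots are nonnegative and denominators are nonzero). *)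

theory Defs
  imports "HOL-Analysis.Analysis"
begin

definition medial_axis :: "'a::real_normed_vector set \<Rightarrow> 'a set" where
  "medial_axis X = {x. x \<notin> X \<and>
     (\<exists>q1\<in>X. \<exists>q2\<in>X. q1 \<noteq> q2 \<and> norm (q1 - x) = infdist x X \<and> norm (q2 - x) = infdist x X)}"

text \<open>Extended-real valued, so that the reach is infinite when the medial axis is empty.\<close>

definition reach :: "'a::real_normed_vector set \<Rightarrow> ereal" where
  "reach X = (INF (q, x)\<in>X \<times> medial_axis X. ereal (norm (q - x)))"

definition cech_complex :: "'a::metric_space set \<Rightarrow> ('a \<Rightarrow> real) \<Rightarrow> 'a set set" where
  "cech_complex P r =
     {\<sigma>. finite \<sigma> \<and> \<sigma> \<noteq> {} \<and> \<sigma> \<subseteq> P \<and> (\<Inter>x\<in>\<sigma>. ball x (r x)) \<noteq> {}}"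

text \<open>Points of the realization are written in barycentric coordinates, as functions on the
  vertices. The geometric realization carries the weak (coherent) topology: a set is open iff
  its trace on every closed simplex is open. The product topology of the function space induces
  the Euclidean topology on the closed simplex spanned by a finite set.\<close>

definition geom_simplex :: "'v set \<Rightarrow> ('v \<Rightarrow> real) set" where
  "geom_simplex \<sigma> = {t. (\<forall>v. 0 \<le> t v) \<and> (\<forall>v. v \<notin> \<sigma> \<longrightarrow> t v = 0) \<and> sum t \<sigma> = 1}"

definition geom_realization :: "'v set set \<Rightarrow> ('v \<Rightarrow> real) topology" where
  "geom_realization K = topology (\<lambda>U. U \<subseteq> \<Union> (geom_simplex ` K) \<and>
     (\<forall>\<sigma>\<in>K. openin (top_of_set (geom_simplex \<sigma>)) (U \<inter> geom_simplex \<sigma>)))"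

lemma openin_geom_realization:
  "openin (geom_realization K) U \<longleftrightarrow> U \<subseteq> \<Union> (geom_simplex ` K) \<and>
     (\<forall>\<sigma>\<in>K. openin (top_of_set (geom_simplex \<sigma>)) (U \<inter> geom_simplex \<sigma>))"
proof -
  have "istopology (\<lambda>U. U \<subseteq> \<Union> (geom_simplex ` K) \<and>
     (\<forall>\<sigma>\<in>K. openin (top_of_set (geom_simplex \<sigma>)) (U \<inter> geom_simplex \<sigma>)))" (is "istopology ?L")
    unfolding istopology_def
  proof (intro conjI allI impI)
    fix S T assume "?L S" "?L T"
    moreover have "(S \<inter> T) \<inter> A = (S \<inter> A) \<inter> (T \<inter> A)" for A by blast
    ultimately show "S \<inter> T \<subseteq> \<Union> (geom_simplex ` K)"
      and "\<forall>\<sigma>\<in>K. openin (top_of_set (geom_simplex \<sigma>)) (S \<inter> T \<inter> geom_simplex \<sigma>)"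
      by (blast, metis openin_Int)
  next
    fix \<K> assume L: "\<forall>S\<in>\<K>. ?L S"
    then show "\<Union>\<K> \<subseteq> \<Union> (geom_simplex ` K)" by blast
    show "\<forall>\<sigma>\<in>K. openin (top_of_set (geom_simplex \<sigma>)) (\<Union>\<K> \<inter> geom_simplex \<sigma>)"
      unfolding Int_Union2 using L by (intro ballI openin_Union) auto
  qed
  then show ?thesis
    by (simp add: geom_realization_def)
qed

lemma topspace_geom_realization [simp]:
  "topspace (geom_realization K) = \<Union> (geom_simplex ` K)"
proof (rule antisym)
  show "topspace (geom_realization K) \<subseteq> \<Union> (geom_simplex ` K)"
    using openin_topspace openin_geom_realization by blast
  have "openin (geom_realization K) (\<Union> (geom_simplex ` K))"
    unfolding openin_geom_realization
  proof (intro conjI ballI)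
    fix \<sigma> assume "\<sigma> \<in> K"
    then have "\<Union> (geom_simplex ` K) \<inter> geom_simplex \<sigma> = geom_simplex \<sigma>" by blast
    then show "openin (top_of_set (geom_simplex \<sigma>)) (\<Union> (geom_simplex ` K) \<inter> geom_simplex \<sigma>)"
      by simp
  qed simp
  then show "\<Union> (geom_simplex ` K) \<subseteq> topspace (geom_realization K)"
    by (rule openin_subset)
qed

end

theory Submission
  imports Defs
begin

text \<open>The first condition on \<open>\<delta>\<close> is satisfiable only for \<open>l \<ge> 0\<close>, that is, for
  \<open>\<delta> + \<tau> - sqrt ((\<tau> - \<epsilon>)\<^sup>2 - rmax\<^sup>2) \<le> rmin\<close>. Under this inequality the segment from a point of the
  union of the balls to its closest point of \<open>X\<close> stays in the union: the open ball of radius \<open>\<tau>\<close> tangent to \<open>X\<close>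
  at the closest point misses \<open>X\<close>. So \<open>X\<close> is a deformation retract of the union of the balls, which is homotopy
  equivalent to the Cech complex by the nerve theorem for convex covers.\<close>

section \<open>Closest points below the reach\<close>

text \<open>Put \<open>a = sqrt ((\<tau> - \<epsilon>)\<^sup>2 - rmax\<^sup>2)\<close>. Then
  \<open>2 * l\<close> is the slack \<open>rmin - (\<delta> + \<tau> - a)\<close>. The number
  \<open>a\<close> is the length of a tangent from a point at distance
  \<open>\<tau> - \<epsilon>\<close> to a ball of radius \<open>rmax\<close>. By the power of a
  point, a ray from the centre of the tangent ball through \<open>y\<close> leaves the ball that
  contains \<open>y\<close> at distance at least \<open>a\<close> from that centre, hence within
  \<open>\<tau> - a\<close> of the closest point, where a ball centred near the closest point takes
  over. The definition of reach speaks only of points with several closest points, so the tangent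
  ball property has to be derived from uniqueness of closest points. The centres may be infinitely
  many and the realization carries the weak topology. Bounded radii let each ball meet only finitely
  many others, so the realization is locally a finite complex.\<close>

lemma infdist_closest_point:
  fixes X :: "'a::euclidean_space set"
  assumes "closed X" and "X \<noteq> {}"
  shows "dist y (closest_point X y) = infdist y X"
  using setdist_closest_point[OF assms, of y] by (simp add: infdist_eq_setdist)

text \<open>A second closest point would put \<open>y\<close> on the medial axis, and then
  \<open>infdist y X\<close> would bound the reach from above.\<close>

lemma closest_point_eqI:
  fixes X :: "'a::euclidean_space set"
  assumes "closed X" and "ereal (infdist y X) < reach X" and "q \<in> X" and "dist y q \<le> infdist y X"
  shows "closest_point X y = q"
proof (rule ccontr)
  let ?p = "closest_point X y"
  assume ne: "?p \<noteq> q"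
  have p: "?p \<in> X" "dist y ?p = infdist y X"
    using assms(1,3) by (blast intro: closest_point_in_set infdist_closest_point)+
  have q: "dist y q = infdist y X"
    using assms by (simp add: infdist_le order_antisym)
  have "y \<notin> X"
    using ne p q by auto
  then have "y \<in> medial_axis X"
    using p q ne assms(3) unfolding medial_axis_def mem_Collect_eq by (metis dist_commute dist_norm)
  then have "reach X \<le> ereal (norm (q - y))"
    unfolding reach_def using assms(3) by (intro INF_lower2[of "(q, y)"]) auto
  with q assms(2) show False
    by (simp add: dist_norm norm_minus_commute)
qed

text \<open>Compactness and uniqueness: the closest points of a sequence tending to \<open>y\<close>
  are bounded, and every subsequential limit is a closest point of \<open>y\<close>, hence the only
  one.\<close>

lemma continuous_on_closest_point_reach:
  fixes X :: "'a::euclidean_space set"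
  assumes X: "closed X" "X \<noteq> {}"
  shows "continuous_on {y. ereal (infdist y X) < reach X} (closest_point X)"
proof (clarsimp simp: continuous_on_iff, rule ccontr)
  fix y and e :: real
  assume y: "ereal (infdist y X) < reach X" and e: "0 < e"
    and no: "\<not> (\<exists>d>0. \<forall>z. ereal (infdist z X) < reach X \<longrightarrow> dist z y < d \<longrightarrow>
                dist (closest_point X z) (closest_point X y) < e)"
  have "\<exists>z. dist z y < inverse (real (Suc n)) \<and> e \<le> dist (closest_point X z) (closest_point X y)" for n
    using no by (metis inverse_positive_iff_positive not_less of_nat_0_less_iff zero_less_Suc)
  then obtain z where z: "\<And>n. dist (z n) y < inverse (real (Suc n))"
      "\<And>n. e \<le> dist (closest_point X (z n)) (closest_point X y)"
    by metis
  have zy: "z \<longlonglongrightarrow> y"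
    unfolding tendsto_dist_iff[of z]
  proof (rule real_tendsto_sandwich[OF _ _ tendsto_const LIMSEQ_inverse_real_of_nat])
    show "\<forall>\<^sub>F n in sequentially. dist (z n) y \<le> inverse (real (Suc n))"
      by (intro always_eventually allI less_imp_le z(1))
  qed simp
  have id: "(\<lambda>n. infdist (z n) X) \<longlonglongrightarrow> infdist y X"
    by (intro tendsto_intros zy)
  define p where "p n = closest_point X (z n)" for n
  have "bounded (range p)"
  proof -
    obtain M where M: "\<And>n. infdist (z n) X \<le> M"
      using convergent_imp_Bseq[OF convergentI[OF id]] unfolding Bseq_def real_norm_def
      by (meson abs_le_D1)
    have "dist y (p n) \<le> 1 + M" for n
    proof -
      have "inverse (real (Suc n)) \<le> 1"
        by (simp add: divide_simps)
      then show ?thesis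
        using dist_triangle[of y "p n" "z n"] z(1)[of n] M[of n] infdist_closest_point[OF X, of "z n"]
        by (auto simp: dist_commute p_def)
    qed
    then show ?thesis
      unfolding bounded_def by blast
  qed
  then obtain q s where s: "strict_mono (s :: nat \<Rightarrow> nat)" and q: "(p \<circ> s) \<longlonglongrightarrow> q"
    using bounded_imp_convergent_subsequence by blast
  have "q \<in> X"
    using closed_sequentially[OF X(1) _ q] closest_point_in_set[OF X] by (auto simp: p_def)
  moreover have "dist y q = infdist y X"
  proof (rule LIMSEQ_unique)
    show "(\<lambda>n. dist ((z \<circ> s) n) ((p \<circ> s) n)) \<longlonglongrightarrow> dist y q"
      using q LIMSEQ_subseq_LIMSEQ[OF zy s] by (intro tendsto_intros)
    show "(\<lambda>n. dist ((z \<circ> s) n) ((p \<circ> s) n)) \<longlonglongrightarrow> infdist y X"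
      using LIMSEQ_subseq_LIMSEQ[OF id s] by (simp add: p_def infdist_closest_point[OF X] o_def)
  qed
  ultimately have "closest_point X y = q"
    using closest_point_eqI[OF X(1) y] by simp
  moreover have "e \<le> dist q (closest_point X y)"
    using tendsto_dist[OF q tendsto_const[of "closest_point X y"]]
    by (rule LIMSEQ_le_const) (use z(2) in \<open>auto simp: p_def\<close>)
  ultimately show False
    using e by simp
qed

text \<open>A Brouwer fixed point of the map that sends \<open>w\<close> to the point at distance \<open>\<eta>\<close> from \<open>z\<close> in the
  direction away from the closest point of \<open>w\<close> has \<open>z\<close> on the segment to its closest point.\<close>

lemma infdist_extend_below_reach:
  fixes X :: "'a::euclidean_space set"
  assumes X: "closed X" and p: "p \<in> X" and u: "norm u = 1"
    and \<sigma>: "0 < \<sigma>" "infdist (p + \<sigma> *\<^sub>R u) X = \<sigma>"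
    and \<eta>: "0 < \<eta>" "ereal (\<sigma> + \<eta>) < reach X"
  shows "infdist (p + (\<sigma> + \<eta>) *\<^sub>R u) X = \<sigma> + \<eta>"
proof -
  define z where "z = p + \<sigma> *\<^sub>R u"
  define \<pi> where "\<pi> = closest_point X"
  define f where "f w = z + (\<eta> / norm (z - \<pi> w)) *\<^sub>R (z - \<pi> w)" for w
  have ne: "X \<noteq> {}"
    using p by auto
  have \<pi>X: "\<pi> w \<in> X" for w
    unfolding \<pi>_def by (rule closest_point_in_set[OF X ne])
  have z\<pi>: "z - \<pi> w \<noteq> 0" for w
    using \<sigma> \<pi>X[of w] by (auto simp: z_def)
  have small: "cball z \<eta> \<subseteq> {y. ereal (infdist y X) < reach X}"
  proof clarsimp
    fix w assume "dist z w \<le> \<eta>"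
    then have "infdist w X \<le> \<sigma> + \<eta>"
      using infdist_triangle[of w X z] \<sigma> by (simp add: z_def dist_commute)
    then show "ereal (infdist w X) < reach X"
      using \<eta>(2) by (meson ereal_less_eq(3) le_less_trans)
  qed
  have "continuous_on (cball z \<eta>) \<pi>"
    unfolding \<pi>_def by (rule continuous_on_subset[OF continuous_on_closest_point_reach[OF X ne] small])
  then have "continuous_on (cball z \<eta>) f"
    unfolding f_def using z\<pi> by (intro continuous_intros) auto
  moreover have "f \<in> cball z \<eta> \<rightarrow> cball z \<eta>"
    using \<eta>(1) z\<pi> by (auto simp: f_def dist_norm)
  ultimately obtain w where w: "w \<in> cball z \<eta>" "f w = w"
    using brouwer[of "cball z \<eta>" f] \<eta>(1) by auto
  have wz: "w - z = (\<eta> / norm (z - \<pi> w)) *\<^sub>R (z - \<pi> w)"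
    using w(2) unfolding f_def by (metis add_diff_cancel_left')
  have nwz: "norm (w - z) = \<eta>"
    using \<eta>(1) z\<pi> by (simp add: wz)
  have "w - \<pi> w = (\<eta> / norm (z - \<pi> w) + 1) *\<^sub>R (z - \<pi> w)"
    using wz by (simp add: algebra_simps)
  then have "norm (w - \<pi> w) = \<bar>\<eta> / norm (z - \<pi> w) + 1\<bar> * norm (z - \<pi> w)"
    by (metis norm_scaleR)
  also have "\<dots> = \<eta> + norm (z - \<pi> w)"
    using \<eta>(1) z\<pi>[of w] by (simp add: field_simps)
  finally have nw: "dist w (\<pi> w) = \<eta> + dist z (\<pi> w)"
    by (simp add: dist_norm)
  have zr: "ereal (infdist z X) < reach X"
    using subsetD[OF small, of z] \<eta>(1) by simp
  \<comment> \<open>\<open>w\<close> lies beyond \<open>z\<close> on the ray from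
    \<open>\<pi> w\<close>. Going back to \<open>z\<close> saves exactly \<open>\<eta>\<close> on
    the distance to \<open>\<pi> w\<close> and at most \<open>\<eta>\<close> on the distance to
    \<open>p\<close>.\<close>
  have "dist z (\<pi> w) \<le> dist z p"
  proof -
    have "dist w (\<pi> w) \<le> dist w p"
      using closest_point_le[OF X p] by (simp add: \<pi>_def)
    then show ?thesis
      using nw nwz dist_triangle[of w p z] by (simp add: dist_norm)
  qed
  moreover have zp: "dist z p = \<sigma>"
    using u \<sigma>(1) by (simp add: z_def dist_norm)
  ultimately have "\<pi> w = \<pi> z" and "\<pi> z = p"
    using closest_point_eqI[OF X zr \<pi>X[of w]] closest_point_eqI[OF X zr p] \<sigma>
    by (auto simp: \<pi>_def z_def)
  then have wp: "\<pi> w = p"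
    by simp
  then have "w - z = (\<eta> / \<sigma>) *\<^sub>R (\<sigma> *\<^sub>R u)"
    using wz zp by (simp add: dist_norm) (simp add: z_def)
  then have "w = p + (\<sigma> + \<eta>) *\<^sub>R u"
    using \<sigma>(1) by (simp add: z_def algebra_simps)
  moreover have "infdist w X = \<sigma> + \<eta>"
    using infdist_closest_point[OF X ne, of w] nw wp zp by (simp add: \<pi>_def)
  ultimately show ?thesis
    by simp
qed

text \<open>The extension is available only strictly below the reach, so the radius \<tau> is
  obtained as a limit of radii \<open>s < \<tau>\<close>.\<close>

lemma reach_tangent_ball:
  fixes X :: "'a::euclidean_space set"
  assumes X: "closed X" and p: "p \<in> X" and u: "norm u = 1"
    and \<sigma>: "0 < \<sigma>" "\<sigma> < \<tau>" "infdist (p + \<sigma> *\<^sub>R u) X = \<sigma>"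
    and \<tau>: "ereal \<tau> \<le> reach X" and q: "q \<in> X"
  shows "\<tau> \<le> dist (p + \<tau> *\<^sub>R u) q"
proof (rule field_le_epsilon)
  fix e :: real assume e: "0 < e"
  \<comment> \<open>The first entry keeps the loss \<open>\<tau> - s\<close> below \<open>e\<close>;
    the midpoint keeps \<open>s\<close> above \<sigma>, so that the extension has positive
    length.\<close>
  define s where "s = max (\<tau> - e / 2) ((\<sigma> + \<tau>) / 2)"
  have s: "\<sigma> < s" "s < \<tau>" "\<tau> - e / 2 \<le> s"
    using e \<sigma> by (auto simp: s_def less_max_iff_disj)
  have "ereal (\<sigma> + (s - \<sigma>)) < reach X"
    using s(2) \<tau> by (simp add: less_le_trans[OF _ \<tau>])
  then have "infdist (p + s *\<^sub>R u) X = s"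
    using infdist_extend_below_reach[OF X p u \<sigma>(1,3), of "s - \<sigma>"] s(1) by simp
  then have "s \<le> dist (p + s *\<^sub>R u) q"
    using infdist_le[OF q] by metis
  also have "\<dots> \<le> dist (p + \<tau> *\<^sub>R u) q + (\<tau> - s)"
  proof -
    have "(p + s *\<^sub>R u) - (p + \<tau> *\<^sub>R u) = (s - \<tau>) *\<^sub>R u"
      by (simp add: algebra_simps)
    then have "dist (p + s *\<^sub>R u) (p + \<tau> *\<^sub>R u) = \<tau> - s"
      using s(2) u by (simp add: dist_norm)
    then show ?thesis
      using dist_triangle[of "p + s *\<^sub>R u" q "p + \<tau> *\<^sub>R u"] by simp
  qed
  finally show "\<tau> \<le> dist (p + \<tau> *\<^sub>R u) q + e"
    using s(3) by simp
qed

section \<open>Segments to the closest point inside the union of balls\<close>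

lemma dist_add_scaleR_unit_sq:
  fixes x p u :: "'a::real_inner"
  assumes "norm u = 1"
  shows "(dist x (p + s *\<^sub>R u))\<^sup>2 = s\<^sup>2 - 2 * s * ((x - p) \<bullet> u) + (norm (x - p))\<^sup>2"
proof -
  have "u \<bullet> u = 1"
    using assms by (simp add: norm_eq_1)
  then show ?thesis
    unfolding dist_norm power2_norm_eq_inner
    by (simp add: algebra_simps inner_diff_left inner_diff_right inner_commute power2_eq_square)
qed

text \<open>Put \<open>a = sqrt ((\<tau> - \<epsilon>)\<^sup>2 - rmax\<^sup>2)\<close>. Of the segment from \<open>y\<close> to its closest point, the part at distance at least \<open>\<tau> - a\<close> from \<open>X\<close> lies in
  the ball that contains \<open>y\<close>, the rest in a ball centred within \<open>\<delta>\<close> of the closest point.\<close>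

lemma closest_point_segment_in_balls:
  fixes X P :: "'a::euclidean_space set"
  assumes X: "X \<noteq> {}" "closed X" and \<tau>: "ereal \<tau> \<le> reach X"
    and rmin: "\<And>x. x \<in> P \<Longrightarrow> rmin \<le> r x"
    and rpos: "\<And>x. x \<in> P \<Longrightarrow> 0 < r x"
    and rmax: "\<And>x. x \<in> P \<Longrightarrow> r x \<le> rmax"
    and \<epsilon>: "\<And>x. x \<in> P \<Longrightarrow> infdist x X \<le> \<epsilon>"
    and cover: "X \<subseteq> (\<Union>x\<in>P. ball x \<delta>)"
    and le: "rmax \<le> \<tau> - \<epsilon>"
    and \<delta>: "\<delta> + \<tau> - sqrt ((\<tau> - \<epsilon>)\<^sup>2 - rmax\<^sup>2) \<le> rmin"
    and x: "x \<in> P" and y: "y \<in> ball x (r x)"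
  shows "closed_segment y (closest_point X y) \<subseteq> (\<Union>x\<in>P. ball x (r x))"
proof -
  define p where "p = closest_point X y"
  define t where "t = dist y p"
  define u where "u = (y - p) /\<^sub>R t"
  define a where "a = sqrt ((\<tau> - \<epsilon>)\<^sup>2 - rmax\<^sup>2)"
  have rm: "0 < rmax" "0 \<le> \<epsilon>"
    using rpos[OF x] rmax[OF x] \<epsilon>[OF x] infdist_nonneg[of x X] by linarith+
  have pX: "p \<in> X"
    unfolding p_def using X by (intro closest_point_in_set)
  have t: "t = infdist y X"
    unfolding t_def p_def using X by (intro infdist_closest_point)
  have t\<tau>: "t < \<tau>"
    using infdist_triangle[of y X x] y \<epsilon>[OF x] rmax[OF x] le by (auto simp: t dist_commute)
  have rmax_sq: "rmax\<^sup>2 \<le> (\<tau> - \<epsilon>)\<^sup>2"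
    using le rm by (intro power_mono) auto
  have a_sq: "a\<^sup>2 = (\<tau> - \<epsilon>)\<^sup>2 - rmax\<^sup>2" and a0: "0 \<le> a"
    using rmax_sq by (auto simp: a_def)
  obtain x' where x': "x' \<in> P" "dist x' p < \<delta>"
    using cover pX by (auto simp: dist_commute)
  have near: "w \<in> ball x' (r x')" if "dist p w \<le> \<tau> - a" for w
    using dist_triangle[of x' w p] that x' rmin[OF x'(1)] \<delta> by (auto simp: a_def)
  show ?thesis
  proof (cases "t = 0")
    case True
    then have "closed_segment y (closest_point X y) = {y}"
      using p_def by (metis closed_segment_idem dist_eq_0_iff t_def)
    then show ?thesis
      using x y by auto
  next
    case False
    then have t0: "0 < t"
      by (simp add: t_def)
    have u: "norm u = 1"
      using False by (simp add: u_def t_def dist_norm)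
    have yu: "y = p + t *\<^sub>R u"
      using False by (simp add: u_def)
    define f where "f s = (dist x (p + s *\<^sub>R u))\<^sup>2" for s
    define \<alpha> where "\<alpha> = (x - p) \<bullet> u"
    have f: "f s = s\<^sup>2 - 2 * s * \<alpha> + (norm (x - p))\<^sup>2" for s
      unfolding f_def \<alpha>_def by (rule dist_add_scaleR_unit_sq[OF u])
    have "f t < (r x)\<^sup>2"
      using y yu by (auto simp: f_def intro!: power_strict_mono)
    \<comment> \<open>The closest point of \<open>x\<close> lies outside the open tangent ball, and
      \<open>x\<close> is within \<epsilon> of it.\<close>
    have "(\<tau> - \<epsilon>) \<le> dist x (p + \<tau> *\<^sub>R u)"
    proof -
      have "\<tau> \<le> dist (p + \<tau> *\<^sub>R u) (closest_point X x)"
        using X t yu by (intro reach_tangent_ball[OF _ pX u t0 t\<tau> _ \<tau>] closest_point_in_set) auto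
      then show ?thesis
        using dist_triangle[of "p + \<tau> *\<^sub>R u" "closest_point X x" x] infdist_closest_point[of X x] X \<epsilon>[OF x]
        by (simp add: dist_commute)
    qed
    then have f\<tau>: "(\<tau> - \<epsilon>)\<^sup>2 \<le> f \<tau>"
      unfolding f_def using le rm by (intro power_mono) auto
    \<comment> \<open>\<open>f\<close> is a monic quadratic. If it drops from \<open>s\<close> to
      \<open>t\<close>, then \<open>t + s < 2 * \<alpha>\<close>, which bounds its growth from
      \<open>t\<close> to \<tau> by \<open>(\<tau> - t) * (\<tau> - s) \<le> a\<^sup>2\<close>, too
      little to reach \<open>(\<tau> - \<epsilon>)\<^sup>2\<close>.\<close>
    have far: "f s < (r x)\<^sup>2" if s: "\<tau> - a < s" "s \<le> t" for s
    proof (rule ccontr)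
      assume fs: "\<not> f s < (r x)\<^sup>2"
      then have st: "s < t"
        using s \<open>f t < (r x)\<^sup>2\<close> by (cases "s = t") auto
      have "f t - f s = (t - s) * (t + s - 2 * \<alpha>)"
        by (simp add: f algebra_simps power2_eq_square)
      then have "(t - s) * (t + s - 2 * \<alpha>) < 0"
        using fs \<open>f t < (r x)\<^sup>2\<close> by linarith
      then have \<alpha>: "t + s < 2 * \<alpha>"
        using st by (simp add: mult_less_0_iff)
      have "f \<tau> = f t + (\<tau> - t) * (\<tau> + t - 2 * \<alpha>)"
        by (simp add: f algebra_simps power2_eq_square)
      also have "\<dots> \<le> f t + (\<tau> - t) * (\<tau> - s)"
        using \<alpha> t\<tau> by (intro add_left_mono mult_left_mono) auto
      also have "\<dots> \<le> f t + (\<tau> - s) * (\<tau> - s)"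
        using st t\<tau> by (intro add_left_mono mult_right_mono) auto
      also have "\<dots> \<le> f t + a * a"
        using s st t\<tau> a0 by (intro add_left_mono mult_mono) auto
      also have "\<dots> < rmax\<^sup>2 + a\<^sup>2"
        using \<open>f t < (r x)\<^sup>2\<close> power_mono[OF rmax[OF x], of 2] rpos[OF x]
        by (simp add: power2_eq_square)
      finally show False
        using f\<tau> a_sq by simp
    qed
    show ?thesis
    proof
      fix w assume "w \<in> closed_segment y (closest_point X y)"
      then obtain c where c: "0 \<le> c" "c \<le> 1" "w = (1 - c) *\<^sub>R y + c *\<^sub>R p"
        by (auto simp: in_segment p_def)
      define s where "s = (1 - c) * t"
      have w: "w = p + s *\<^sub>R u"
        by (simp add: c(3) yu s_def algebra_simps)
      have s: "0 \<le> s" "s \<le> t"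
        using c t0 by (auto simp: s_def mult_left_le_one_le)
      show "w \<in> (\<Union>x\<in>P. ball x (r x))"
      proof (cases "s \<le> \<tau> - a")
        case True
        then have "dist p w \<le> \<tau> - a"
          using s u by (simp add: w dist_norm)
        then show ?thesis
          using near x'(1) by blast
      next
        case False
        then have "dist x w < r x"
          using far[of s] s rpos[OF x] by (auto simp: f_def w intro: power_less_imp_less_base)
        then show ?thesis
          using x by auto
      qed
    qed
  qed
qed

lemma union_of_balls_homotopy_equivalent:
  fixes X P :: "'a::euclidean_space set"
  assumes X: "X \<noteq> {}" "closed X" and \<tau>: "ereal \<tau> \<le> reach X"
    and rmin: "\<And>x. x \<in> P \<Longrightarrow> rmin \<le> r x"
    and rpos: "\<And>x. x \<in> P \<Longrightarrow> 0 < r x"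
    and rmax: "\<And>x. x \<in> P \<Longrightarrow> r x \<le> rmax"
    and \<epsilon>: "\<And>x. x \<in> P \<Longrightarrow> infdist x X \<le> \<epsilon>"
    and cover: "X \<subseteq> (\<Union>x\<in>P. ball x \<delta>)" and \<delta>min: "\<delta> \<le> rmin"
    and le: "rmax \<le> \<tau> - \<epsilon>"
    and \<delta>: "\<delta> + \<tau> - sqrt ((\<tau> - \<epsilon>)\<^sup>2 - rmax\<^sup>2) \<le> rmin"
  shows "top_of_set X homotopy_equivalent_space top_of_set (\<Union>x\<in>P. ball x (r x))"
proof -
  define U where "U = (\<Union>x\<in>P. ball x (r x))"
  let ?\<pi> = "closest_point X"
  have XU: "X \<subseteq> U"
    using cover \<delta>min rmin subset_ball[of \<delta>] unfolding U_def by (blast intro: order_trans)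
  \<comment> \<open>A point of a ball is closer to \<open>X\<close> than
    \<open>rmax + \<epsilon> \<le> \<tau>\<close>, so closest points are unique and vary
    continuously on \<open>U\<close>.\<close>
  have "U \<subseteq> {y. ereal (infdist y X) < reach X}"
  proof (clarsimp simp: U_def)
    fix x y assume x: "x \<in> P" and y: "dist x y < r x"
    have "infdist y X < \<tau>"
      using infdist_triangle[of y X x] y \<epsilon>[OF x] rmax[OF x] le by (auto simp: dist_commute)
    then show "ereal (infdist y X) < reach X"
      using \<tau> by (simp add: less_le_trans[OF _ \<tau>])
  qed
  then have cont: "continuous_on U ?\<pi>"
    using continuous_on_closest_point_reach[OF X(2,1)] continuous_on_subset by blast
  have "closed_segment y (?\<pi> y) \<subseteq> U" if "y \<in> U" for y
    using that closest_point_segment_in_balls[where r = r, OF X \<tau> rmin rpos rmax \<epsilon> cover le \<delta>]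
    unfolding U_def by blast
  then have "homotopic_with_canon (\<lambda>x. True) U U id ?\<pi>"
    using cont by (intro homotopic_with_linear) auto
  then have "homotopic_with_canon (\<lambda>x. True) U U (id \<circ> ?\<pi>) id"
    by (simp add: homotopic_with_symD)
  moreover have "retraction_maps (top_of_set U) (top_of_set X) ?\<pi> id"
    using cont XU closest_point_in_set[OF X(2,1)] closest_point_self
    by (auto simp: retraction_maps_def)
  ultimately show ?thesis
    unfolding U_def[symmetric]
    by (metis deformation_retraction_imp_homotopy_equivalent_space homotopy_equivalent_space_sym)
qed

section \<open>The first condition on \<delta>\<close>

text \<open>If \<open>l < 0\<close>, put \<open>m = - l\<close> and \<open>B = a\<^sup>2 + a * m + m\<^sup>2\<close>. The bound on \<open>R\<close> gives
  \<open>B \<le> \<tau>\<^sup>2 - R\<close>, so the radicand is at least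
  \<open>\<tau>\<^sup>2 + (a + m)\<^sup>2 - 2 * \<tau> * sqrt B \<ge> (\<tau> - a - m)\<^sup>2\<close>, while the hypothesis bounds it by
  \<open>(\<tau> - a - 2 * m)\<^sup>2\<close>.\<close>

lemma sampling_condition_imp_gap_nonneg:
  fixes \<tau> a l R A :: real
  assumes \<tau>: "0 < \<tau>" and a: "0 \<le> a"
    and R: "R \<le> (2 * \<tau>\<^sup>2 - a\<^sup>2 - l\<^sup>2 - (a - l)\<^sup>2) / 2"
    and A: "A = \<tau>\<^sup>2 - a\<^sup>2 - l\<^sup>2 - (a\<^sup>2 + l\<^sup>2 + (a - l)\<^sup>2) * (\<tau> / sqrt (\<tau>\<^sup>2 - R) - 1)"
    and "0 \<le> A" and cond: "sqrt A \<le> \<tau> - a + 2 * l"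
  shows "0 \<le> l"
proof (rule ccontr)
  assume "\<not> 0 \<le> l"
  define m where "m = - l"
  define b where "b = sqrt (a\<^sup>2 + a * m + m\<^sup>2)"
  have m: "0 < m"
    using \<open>\<not> 0 \<le> l\<close> by (simp add: m_def)
  have "0 < a\<^sup>2 + a * m + m\<^sup>2"
    using a m by (simp add: add_nonneg_pos)
  then have b: "0 < b" "b\<^sup>2 = a\<^sup>2 + a * m + m\<^sup>2"
    by (auto simp: b_def)
  have B: "a\<^sup>2 + l\<^sup>2 + (a - l)\<^sup>2 = 2 * b\<^sup>2"
    unfolding b(2) by (simp add: m_def power2_eq_square algebra_simps)
  have "b\<^sup>2 \<le> (a + m)\<^sup>2"
    unfolding b(2) using a m by (simp add: power2_eq_square algebra_simps)
  then have bam: "b \<le> a + m"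
    using a m by (meson abs_le_square_iff add_nonneg_nonneg less_imp_le power2_le_imp_le)
  have "b\<^sup>2 \<le> \<tau>\<^sup>2 - R"
    using R B by (simp add: field_simps)
  then have "b \<le> sqrt (\<tau>\<^sup>2 - R)"
    by (rule real_le_rsqrt)
  moreover from this have "0 < sqrt (\<tau>\<^sup>2 - R)"
    using b(1) by linarith
  ultimately have "\<tau> / sqrt (\<tau>\<^sup>2 - R) \<le> \<tau> / b"
    using b(1) \<tau> by (intro divide_left_mono mult_pos_pos) auto
  then have "2 * b\<^sup>2 * (\<tau> / sqrt (\<tau>\<^sup>2 - R) - 1) \<le> 2 * b\<^sup>2 * (\<tau> / b - 1)"
    by (intro mult_left_mono) auto
  also have "\<dots> = 2 * b * \<tau> - 2 * b\<^sup>2"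
    using b(1) by (simp add: power2_eq_square field_simps)
  finally have "\<tau>\<^sup>2 - a\<^sup>2 - l\<^sup>2 - 2 * b * \<tau> + 2 * b\<^sup>2 \<le> A"
    unfolding A B by linarith
  moreover have "2 * b\<^sup>2 - a\<^sup>2 - l\<^sup>2 = (a + m)\<^sup>2"
    using B by (simp add: m_def)
  moreover have "2 * b * \<tau> \<le> 2 * (a + m) * \<tau>"
    using bam \<tau> by simp
  ultimately have "\<tau>\<^sup>2 + (a + m)\<^sup>2 - 2 * (a + m) * \<tau> \<le> A"
    by linarith
  then have "(\<tau> - a - m)\<^sup>2 \<le> A"
    by (simp add: power2_eq_square algebra_simps)
  then have "\<bar>\<tau> - a - m\<bar> \<le> sqrt A"
    using real_le_rsqrt[of "\<bar>\<tau> - a - m\<bar>" A] by simp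
  then show False
    using cond m by (simp add: m_def)
qed

section \<open>The nerve theorem for star-finite convex open covers\<close>

definition nerve :: "'i set \<Rightarrow> ('i \<Rightarrow> 'a set) \<Rightarrow> 'i set set" where
  "nerve I B = {\<sigma>. finite \<sigma> \<and> \<sigma> \<noteq> {} \<and> \<sigma> \<subseteq> I \<and> (\<Inter>i\<in>\<sigma>. B i) \<noteq> {}}"

definition support :: "('v \<Rightarrow> real) \<Rightarrow> 'v set" where
  "support t = {v. t v \<noteq> 0}"

lemma cech_complex_eq_nerve: "cech_complex P r = nerve P (\<lambda>x. ball x (r x))"
  by (simp add: cech_complex_def nerve_def)

lemma nerve_subset:
  assumes "\<sigma> \<in> nerve I B" and "\<rho> \<subseteq> \<sigma>" and "\<rho> \<noteq> {}"
  shows "\<rho> \<in> nerve I B"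
proof -
  have \<sigma>: "finite \<sigma>" "\<sigma> \<subseteq> I" "(\<Inter>i\<in>\<sigma>. B i) \<noteq> {}"
    using assms(1) by (simp_all add: nerve_def)
  moreover have "(\<Inter>i\<in>\<sigma>. B i) \<subseteq> (\<Inter>i\<in>\<rho>. B i)"
    using assms(2) by (rule INF_superset_mono) simp
  ultimately have "finite \<rho>" "\<rho> \<subseteq> I" "(\<Inter>i\<in>\<rho>. B i) \<noteq> {}"
    using assms(2) by (simp_all add: finite_subset, blast+)
  then show ?thesis
    using assms(3) by (simp add: nerve_def)
qed

section \<open>Weak topology and coordinate topology of the realization\<close>

lemma closed_geom_simplex: "closed (geom_simplex \<sigma>)"
proof -
  have "geom_simplex \<sigma> = (\<Inter>v. {t. 0 \<le> t v}) \<inter> (\<Inter>v\<in>-\<sigma>. {t. t v = 0}) \<inter> {t. sum t \<sigma> = 1}"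
    by (auto simp: geom_simplex_def)
  moreover have "closed \<dots>"
    by (intro closed_Int closed_INT ballI closed_Collect_le closed_Collect_eq continuous_intros
        continuous_on_product_coordinates)
  ultimately show ?thesis
    by simp
qed

text \<open>The support is the carrier of \<open>t\<close>, the smallest face containing it; it
  replaces the choice of a simplex below.\<close>

lemma geom_simplex_support:
  assumes "t \<in> geom_simplex \<sigma>" and "finite \<sigma>"
  shows "support t \<subseteq> \<sigma>" and "finite (support t)" and "support t \<noteq> {}"
    and "t \<in> geom_simplex (support t)"
proof -
  show sub: "support t \<subseteq> \<sigma>" and fin: "finite (support t)"
    using assms by (auto simp: geom_simplex_def support_def intro: finite_subset)
  have "sum t (support t) = sum t \<sigma>"
    using assms(2) sub by (intro sum.mono_neutral_left) (auto simp: support_def)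
  then show "t \<in> geom_simplex (support t)"
    using assms(1) by (auto simp: geom_simplex_def support_def)
  then show "support t \<noteq> {}"
    by (auto simp: geom_simplex_def)
qed

text \<open>Near a point with positive \<open>v\<close>-th coordinate only the finitely many neighbours of \<open>v\<close> matter,
  so that the weak topology agrees with the topology of the finite-dimensional subcomplex on them.\<close>

lemma geom_realization_eq_top_of_set:
  assumes fin: "\<And>\<sigma>. \<sigma> \<in> K \<Longrightarrow> finite \<sigma>" and star: "\<And>v. finite (\<Union>{\<sigma>\<in>K. v \<in> \<sigma>})"
  shows "geom_realization K = top_of_set (\<Union> (geom_simplex ` K))"
proof (rule topology_eq[THEN iffD2], intro allI iffI)
  fix W assume W: "openin (geom_realization K) W"
  then have sub: "W \<subseteq> \<Union> (geom_simplex ` K)"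
    and op: "\<And>\<sigma>. \<sigma> \<in> K \<Longrightarrow> openin (top_of_set (geom_simplex \<sigma>)) (W \<inter> geom_simplex \<sigma>)"
    by (auto simp: openin_geom_realization)
  show "openin (top_of_set (\<Union> (geom_simplex ` K))) W"
  proof (subst openin_subopen, intro ballI)
    fix t assume "t \<in> W"
    then obtain \<rho> where \<rho>: "\<rho> \<in> K" "t \<in> geom_simplex \<rho>"
      using sub by blast
    then obtain v where v: "t v \<noteq> 0"
      using geom_simplex_support(3)[OF \<rho>(2) fin] by (auto simp: support_def)
    define S where "S = {\<sigma>\<in>K. v \<in> \<sigma>}"
    have "finite S"
      using star[of v] finite_subset[of S "Pow (\<Union>S)"] by (auto simp: S_def)
    \<comment> \<open>The part of the closed star of \<open>v\<close> outside \<open>W\<close>, a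
      finite union of closed sets. Every simplex with a point of nonzero \<open>v\<close>-th
      coordinate belongs to \<open>S\<close>, so removing \<open>C\<close> leaves only points of
      \<open>W\<close>.\<close>
    define C where "C = (\<Union>\<sigma>\<in>S. geom_simplex \<sigma> - W)"
    have "closed C"
      unfolding C_def
    proof (intro closed_UN \<open>finite S\<close> ballI)
      fix \<sigma> assume "\<sigma> \<in> S"
      then have "closedin (top_of_set (geom_simplex \<sigma>)) (geom_simplex \<sigma> - W \<inter> geom_simplex \<sigma>)"
        using op by (auto simp: closedin_def S_def double_diff Diff_Diff_Int)
      then show "closed (geom_simplex \<sigma> - W)"
        using closed_geom_simplex closedin_closed_trans by (metis Diff_Int2 Int_absorb)
    qed
    moreover have "open {s. s v \<noteq> (0::real)}"
      by (intro open_Collect_neq continuous_intros continuous_on_product_coordinates)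
    ultimately have "open ({s. s v \<noteq> 0} - C)"
      by blast
    then have "openin (top_of_set (\<Union> (geom_simplex ` K)))
        (\<Union> (geom_simplex ` K) \<inter> ({s. s v \<noteq> 0} - C))"
      by blast
    moreover have "\<Union> (geom_simplex ` K) \<inter> ({s. s v \<noteq> 0} - C) \<subseteq> W"
      by (auto simp: C_def S_def geom_simplex_def)
    moreover have "t \<in> \<Union> (geom_simplex ` K) \<inter> ({s. s v \<noteq> 0} - C)"
      using \<open>t \<in> W\<close> sub v by (auto simp: C_def)
    ultimately show "\<exists>T. openin (top_of_set (\<Union> (geom_simplex ` K))) T \<and> t \<in> T \<and> T \<subseteq> W"
      by blast
  qed
next
  fix W assume "openin (top_of_set (\<Union> (geom_simplex ` K))) W"
  then obtain T where T: "open T" "W = \<Union> (geom_simplex ` K) \<inter> T"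
    by (auto simp: openin_open)
  have "W \<inter> geom_simplex \<sigma> = geom_simplex \<sigma> \<inter> T" if "\<sigma> \<in> K" for \<sigma>
    using T that by auto
  then show "openin (geom_realization K) W"
    using T by (auto simp: openin_geom_realization)
qed

text \<open>Meant for maps given by a sum over a finite vertex set that can be fixed only near each
  point.\<close>

lemma continuous_on_locally:
  assumes "\<And>x. x \<in> S \<Longrightarrow> \<exists>N. openin (top_of_set S) N \<and> x \<in> N \<and> continuous_on N f"
  shows "continuous_on S f"
  unfolding continuous_on_def
proof
  fix x assume x: "x \<in> S"
  obtain T where T: "open T" "x \<in> T" "continuous_on (S \<inter> T) f"
    using assms[OF x] by (metis IntE openin_open)
  then have "(f \<longlongrightarrow> f x) (at x within S \<inter> T)"
    using x by (simp add: continuous_on_def)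
  moreover have "at x within S = at x within S \<inter> T"
    using T by (intro at_within_nhd[of x T]) auto
  ultimately show "(f \<longlongrightarrow> f x) (at x within S)"
    by simp
qed

text \<open>The common simplex is convex, and in the product topology the straight-line homotopy is
  continuous as soon as its coordinates are.\<close>

lemma homotopic_linear_in_simplices:
  assumes f: "continuous_on S f" and g: "continuous_on S g"
    and K: "\<And>x. x \<in> S \<Longrightarrow> \<exists>\<sigma>\<in>K. f x \<in> geom_simplex \<sigma> \<and> g x \<in> geom_simplex \<sigma>"
  shows "homotopic_with_canon (\<lambda>_. True) S (\<Union> (geom_simplex ` K)) f g"
proof -
  define h where "h = (\<lambda>(s::real, x) v. (1 - s) * f x v + s * g x v)"
  have coord: "continuous_on S (\<lambda>x. k x v)" if "continuous_on S k" for k :: "_ \<Rightarrow> _ \<Rightarrow> real" and v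
    using continuous_on_compose2[OF continuous_on_product_coordinates that] by auto
  have "continuous_on ({0..1} \<times> S) (\<lambda>p. k (snd p) v)"
    if "continuous_on S k" for k :: "_ \<Rightarrow> _ \<Rightarrow> real" and v
    by (rule continuous_on_compose2[OF coord[OF that]]) (auto intro: continuous_intros)
  then have "continuous_on ({0..1} \<times> S) h"
    unfolding h_def case_prod_unfold using f g by (intro continuous_intros)
  moreover have "h (s, x) \<in> \<Union> (geom_simplex ` K)" if "s \<in> {0..1}" "x \<in> S" for s x
  proof -
    obtain \<sigma> where "\<sigma> \<in> K" "f x \<in> geom_simplex \<sigma>" "g x \<in> geom_simplex \<sigma>"
      using K[OF \<open>x \<in> S\<close>] by blast
    moreover from this have "h (s, x) \<in> geom_simplex \<sigma>"
      using that by (auto simp: h_def geom_simplex_def sum.distrib simp flip: sum_distrib_left)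
    ultimately show ?thesis
      by blast
  qed
  ultimately show ?thesis
    unfolding homotopic_with_def
    by (intro exI[of _ h]) (auto simp: h_def prod_topology_subtopology_eu)
qed

text \<open>The homotopy inverse \<open>nerve_map\<close> of a partition of unity averages one point of each cell
  \<open>\<Inter>i\<in>\<sigma>. B i\<close>, with weights that vanish unless \<open>\<sigma>\<close> contains the superlevel set of \<open>t\<close> at the
  level below. Hence \<open>nerve_map t\<close> lies in \<open>B v\<close> whenever \<open>t v\<close> reaches the level, and cutting \<open>t\<close> off at the
  level gives a point in the simplex of all \<open>i\<close> with \<open>nerve_map t \<in> B i\<close>; the partition of unity maps \<open>nerve_map t\<close>
  into the same simplex. The set \<open>F\<close> may be any finite superset of the support of \<open>t\<close>; for continuity
  it has to be locally constant, which the support is not.\<close>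

definition level :: "'v set \<Rightarrow> ('v \<Rightarrow> real) \<Rightarrow> real" where
  "level F t = (\<Sum>v\<in>F. (t v)\<^sup>2) / 2"

definition nerve_weight :: "'v set \<Rightarrow> ('v \<Rightarrow> real) \<Rightarrow> 'v set \<Rightarrow> real" where
  "nerve_weight F t \<sigma> = (\<Prod>v\<in>F. if v \<in> \<sigma> then t v else max 0 (1 - t v / level F t))"

context
  fixes I :: "'i set" and B :: "'i \<Rightarrow> 'a::real_normed_vector set"
  assumes B: "\<And>i. i \<in> I \<Longrightarrow> open (B i)" "\<And>i. i \<in> I \<Longrightarrow> convex (B i)"
    and star: "\<And>i. i \<in> I \<Longrightarrow> finite {j\<in>I. B i \<inter> B j \<noteq> {}}"
begin

abbreviation (input) "K \<equiv> nerve I B"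
abbreviation (input) "R \<equiv> \<Union> (geom_simplex ` nerve I B)"
abbreviation (input) "U \<equiv> \<Union>i\<in>I. B i"

definition neighbours :: "'i \<Rightarrow> 'i set" where
  "neighbours i = {j\<in>I. B i \<inter> B j \<noteq> {}}"

lemma nerve_subset_neighbours: "\<sigma> \<in> K \<Longrightarrow> i \<in> \<sigma> \<Longrightarrow> \<sigma> \<subseteq> neighbours i"
  by (auto simp: nerve_def neighbours_def)

lemma finite_neighbours: "i \<in> I \<Longrightarrow> finite (neighbours i)"
  using star by (simp add: neighbours_def)

lemma geom_realization_nerve: "geom_realization K = top_of_set R"
proof (rule geom_realization_eq_top_of_set)
  show "finite (\<Union>{\<sigma>\<in>K. i \<in> \<sigma>})" for i
  proof (cases "i \<in> I")
    case True
    then show ?thesis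
      using nerve_subset_neighbours by (intro finite_subset[OF _ finite_neighbours[OF True]]) blast
  next
    case False
    then have "{\<sigma>\<in>K. i \<in> \<sigma>} = {}"
      by (auto simp: nerve_def)
    then show ?thesis
      by (simp only: Union_empty finite.emptyI)
  qed
qed (auto simp: nerve_def)

lemma realizationD:
  assumes "t \<in> R"
  shows "support t \<in> K" and "t \<in> geom_simplex (support t)"
proof -
  obtain \<sigma> where \<sigma>: "\<sigma> \<in> K" "t \<in> geom_simplex \<sigma>"
    using assms by blast
  have "finite \<sigma>"
    using \<sigma>(1) by (simp add: nerve_def)
  then show "support t \<in> K" "t \<in> geom_simplex (support t)"
    using geom_simplex_support[OF \<sigma>(2)] nerve_subset[OF \<sigma>(1)] by auto
qed

lemma realization_nonneg: "t \<in> R \<Longrightarrow> 0 \<le> t v"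
  by (auto simp: geom_simplex_def)

lemma level_mono_neutral:
  assumes "finite F" "support t \<subseteq> F"
  shows "level F t = level (support t) t"
proof -
  have "(\<Sum>v\<in>F. (t v)\<^sup>2) = (\<Sum>v\<in>support t. (t v)\<^sup>2)"
    using assms by (intro sum.mono_neutral_right) (auto simp: support_def)
  then show ?thesis
    by (simp add: level_def)
qed

lemma level_pos:
  assumes "t \<in> R"
  shows "0 < level (support t) t"
proof -
  have "finite (support t)" "support t \<noteq> {}"
    using realizationD(1)[OF assms] by (auto simp: nerve_def)
  then have "0 < (\<Sum>v\<in>support t. (t v)\<^sup>2)"
    by (intro sum_pos) (auto simp: support_def)
  then show ?thesis
    by (simp add: level_def)
qed

text \<open>The coordinates sum to 1, so the sum of their squares is a weighted mean of them and
  some coordinate reaches it; the level is half of that positive number.\<close>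

lemma level_less:
  assumes "t \<in> R"
  obtains v where "v \<in> support t" "level (support t) t < t v"
proof (rule ccontr)
  let ?S = "support t"
  assume "\<not> thesis"
  with that have le: "t v \<le> level ?S t" if "v \<in> ?S" for v
    using \<open>v \<in> ?S\<close> by force
  have "(\<Sum>v\<in>?S. (t v)\<^sup>2) \<le> (\<Sum>v\<in>?S. level ?S t * t v)"
    using le realization_nonneg[OF assms]
    by (intro sum_mono) (auto simp: power2_eq_square intro: mult_right_mono)
  also have "\<dots> = level ?S t"
    using realizationD(2)[OF assms] by (simp add: geom_simplex_def flip: sum_distrib_left)
  finally show False
    using level_pos[OF assms] by (simp add: level_def)
qed

section \<open>The map from the realization to the union\<close>

definition common_point :: "'i set \<Rightarrow> 'a" where
  "common_point \<sigma> = (SOME z. z \<in> (\<Inter>i\<in>\<sigma>. B i))"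

definition nerve_map_on :: "'i set \<Rightarrow> ('i \<Rightarrow> real) \<Rightarrow> 'a" where
  "nerve_map_on F t = (\<Sum>\<sigma>\<in>{\<sigma>\<in>K. \<sigma> \<subseteq> F}.
     (nerve_weight F t \<sigma> / (\<Sum>\<rho>\<in>{\<rho>\<in>K. \<rho> \<subseteq> F}. nerve_weight F t \<rho>)) *\<^sub>R common_point \<sigma>)"

definition nerve_map :: "('i \<Rightarrow> real) \<Rightarrow> 'a" where
  "nerve_map t = nerve_map_on (support t) t"

lemma common_point: "\<sigma> \<in> K \<Longrightarrow> i \<in> \<sigma> \<Longrightarrow> common_point \<sigma> \<in> B i"
  unfolding common_point_def nerve_def by (metis (mono_tags, lifting) INT_E ex_in_conv mem_Collect_eq someI_ex)

lemma nerve_weight_nonneg: "t \<in> R \<Longrightarrow> 0 \<le> nerve_weight F t \<sigma>"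
  unfolding nerve_weight_def using realization_nonneg[of t] by (intro prod_nonneg) auto

text \<open>A vertex of \<open>F\<close> outside the support contributes the factor 1 if it is not
  in \<sigma> and 0 if it is, so enlarging \<open>F\<close> only adds cells of weight 0.\<close>

lemma nerve_weight_mono_neutral:
  assumes "finite F" "support t \<subseteq> F"
  shows "nerve_weight F t \<sigma> = (if \<sigma> \<inter> F \<subseteq> support t then nerve_weight (support t) t \<sigma> else 0)"
proof (cases "\<sigma> \<inter> F \<subseteq> support t")
  case True
  then have "nerve_weight F t \<sigma> = (\<Prod>v\<in>support t. if v \<in> \<sigma> then t v else max 0 (1 - t v / level F t))"
    unfolding nerve_weight_def using assms
    by (intro prod.mono_neutral_right) (auto simp: support_def)
  then show ?thesis
    using True level_mono_neutral[OF assms] by (simp add: nerve_weight_def cong: if_cong)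
next
  case False
  then show ?thesis
    unfolding nerve_weight_def using assms by (auto simp: prod_zero_iff support_def)
qed

lemma nerve_map_on_eq:
  assumes "finite F" "support t \<subseteq> F"
  shows "nerve_map_on F t = nerve_map t"
proof -
  let ?w = "nerve_weight F t"
  have fin: "finite {\<sigma>\<in>K. \<sigma> \<subseteq> F}"
    using assms(1) by (auto intro: finite_subset[of _ "Pow F"])
  have w: "?w \<sigma> = (if \<sigma> \<subseteq> support t then nerve_weight (support t) t \<sigma> else 0)" if "\<sigma> \<subseteq> F" for \<sigma>
    using nerve_weight_mono_neutral[OF assms, of \<sigma>] that by (simp add: Int_absorb2)
  have *: "(\<Sum>\<sigma>\<in>{\<sigma>\<in>K. \<sigma> \<subseteq> F}. ?w \<sigma>) = (\<Sum>\<sigma>\<in>{\<sigma>\<in>K. \<sigma> \<subseteq> support t}. nerve_weight (support t) t \<sigma>)"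
    using fin assms(2) w by (intro sum.mono_neutral_cong_right) auto
  show ?thesis
    unfolding nerve_map_def nerve_map_on_def * using fin assms(2) w
    by (intro sum.mono_neutral_cong_right) auto
qed

text \<open>The factors are \<open>t v > 0\<close> on the support and 1 off it. This one cell makes
  the normalising sum nonzero.\<close>

lemma nerve_weight_support_pos:
  assumes "t \<in> R"
  shows "0 < nerve_weight F t (support t)"
proof -
  have "0 < t v" if "t v \<noteq> 0" for v
    using realization_nonneg[OF assms, of v] that by linarith
  then show ?thesis
    unfolding nerve_weight_def by (intro prod_pos) (simp add: support_def)
qed

lemma sum_nerve_weight_pos:
  assumes "t \<in> R" "finite F" "support t \<subseteq> F"
  shows "0 < (\<Sum>\<sigma>\<in>{\<sigma>\<in>K. \<sigma> \<subseteq> F}. nerve_weight F t \<sigma>)"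
proof (rule sum_pos2)
  show "finite {\<sigma>\<in>K. \<sigma> \<subseteq> F}"
    using assms(2) by (auto intro: finite_subset[of _ "Pow F"])
  show "support t \<in> {\<sigma>\<in>K. \<sigma> \<subseteq> F}"
    using realizationD(1)[OF assms(1)] assms(3) by simp
qed (rule nerve_weight_support_pos[OF assms(1)] nerve_weight_nonneg[OF assms(1)])+

lemma nerve_map_in:
  assumes t: "t \<in> R" and v: "level (support t) t \<le> t v"
  shows "nerve_map t \<in> B v"
proof -
  let ?S = "support t"
  let ?w = "nerve_weight ?S t"
  let ?N = "{\<sigma>\<in>K. \<sigma> \<subseteq> ?S}"
  let ?M = "{\<sigma>\<in>?N. ?w \<sigma> \<noteq> 0}"
  have S: "?S \<in> K" "finite ?S"
    using realizationD(1)[OF t] by (auto simp: nerve_def)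
  have fin: "finite ?N"
    using S(2) by (auto intro: finite_subset[of _ "Pow ?S"])
  have vS: "v \<in> ?S"
    using level_pos[OF t] v by (auto simp: support_def)
  have "nerve_map t = (\<Sum>\<sigma>\<in>?M. (?w \<sigma> / sum ?w ?N) *\<^sub>R common_point \<sigma>)"
    unfolding nerve_map_def nerve_map_on_def using fin by (intro sum.mono_neutral_right) auto
  also have "\<dots> \<in> B v"
  proof (rule convex_sum)
    show "finite ?M"
      using fin by (rule rev_finite_subset) blast
    show "convex (B v)"
      using B(2) S(1) vS by (auto simp: nerve_def)
    have "sum ?w ?M = sum ?w ?N"
      using fin by (intro sum.mono_neutral_left) auto
    then show "(\<Sum>\<sigma>\<in>?M. ?w \<sigma> / sum ?w ?N) = 1"
      using sum_nerve_weight_pos[OF t S(2) subset_refl] by (simp flip: sum_divide_distrib)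
    show "0 \<le> ?w \<sigma> / sum ?w ?N" for \<sigma>
      using sum_nerve_weight_pos[OF t S(2) subset_refl] nerve_weight_nonneg[OF t] by (simp add: less_imp_le)
    fix \<sigma> assume \<sigma>: "\<sigma> \<in> ?M"
    have "v \<in> \<sigma>"
    proof (rule ccontr)
      assume "v \<notin> \<sigma>"
      moreover have "max 0 (1 - t v / level ?S t) = 0"
        using v level_pos[OF t] by (simp add: max_def field_simps)
      ultimately have "?w \<sigma> = 0"
        unfolding nerve_weight_def using S(2) vS by (auto simp: prod_zero_iff)
      then show False
        using \<sigma> by simp
    qed
    then show "common_point \<sigma> \<in> B v"
      using \<sigma> common_point by blast
  qed
  finally show ?thesis .
qed

text \<open>The open star of a vertex \<open>i\<close> of the carrier. All carriers of its points
  lie in \<open>neighbours i\<close>, which serves as the locally constant \<open>F\<close>.\<close>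

lemma realization_star_nhd:
  assumes "t \<in> R"
  obtains i where "i \<in> I" "openin (top_of_set R) {s\<in>R. s i \<noteq> 0}" "t \<in> {s\<in>R. s i \<noteq> 0}"
    "\<And>s. s \<in> R \<Longrightarrow> s i \<noteq> 0 \<Longrightarrow> support s \<subseteq> neighbours i"
proof -
  obtain i where i: "i \<in> support t" "i \<in> I"
    using realizationD(1)[OF assms] by (auto simp: nerve_def)
  have "open {s. s i \<noteq> (0::real)}"
    by (intro open_Collect_neq continuous_intros continuous_on_product_coordinates)
  then have "openin (top_of_set R) (R \<inter> {s. s i \<noteq> 0})"
    by blast
  moreover have "R \<inter> {s. s i \<noteq> 0} = {s\<in>R. s i \<noteq> 0}"
    by blast
  moreover have "support s \<subseteq> neighbours i" if "s \<in> R" "s i \<noteq> 0" for s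
    using nerve_subset_neighbours[OF realizationD(1)[OF that(1)], of i] that(2) by (simp add: support_def)
  ultimately show thesis
    using that[of i] i assms by (simp add: support_def)
qed

lemma continuous_on_coordinate: "continuous_on S (\<lambda>t. t v :: real)"
  by (rule continuous_on_subset[OF continuous_on_product_coordinates]) simp

lemma continuous_on_level: "continuous_on S (level F)"
  unfolding level_def by (intro continuous_on_divide continuous_on_sum continuous_on_power continuous_on_const
      continuous_on_coordinate) simp

lemma continuous_on_nerve_map: "continuous_on R nerve_map"
proof (rule continuous_on_locally)
  fix t assume t: "t \<in> R"
  obtain i where i: "i \<in> I" "openin (top_of_set R) {s\<in>R. s i \<noteq> 0}" "t \<in> {s\<in>R. s i \<noteq> 0}"
    and sup: "\<And>s. s \<in> R \<Longrightarrow> s i \<noteq> 0 \<Longrightarrow> support s \<subseteq> neighbours i"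
    by (rule realization_star_nhd[OF t]) blast
  let ?N = "{s\<in>R. s i \<noteq> 0}" and ?F = "neighbours i"
  have fin: "finite ?F"
    using finite_neighbours[OF i(1)] .
  have lev: "level ?F s \<noteq> 0" if "s \<in> ?N" for s
    using that level_pos[of s] level_mono_neutral[OF fin sup, of s] by simp
  have tot: "(\<Sum>\<sigma>\<in>{\<sigma>\<in>K. \<sigma> \<subseteq> ?F}. nerve_weight ?F s \<sigma>) \<noteq> 0" if "s \<in> ?N" for s
    using sum_nerve_weight_pos[OF _ fin sup, of s] that by simp
  have w: "continuous_on ?N (\<lambda>s. nerve_weight ?F s \<sigma>)" for \<sigma>
    unfolding nerve_weight_def
  proof (intro continuous_on_prod)
    fix v
    show "continuous_on ?N (\<lambda>s. if v \<in> \<sigma> then s v else max 0 (1 - s v / level ?F s))"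
      using lev by (cases "v \<in> \<sigma>") (auto intro!: continuous_intros continuous_on_coordinate continuous_on_level)
  qed
  have "continuous_on ?N (nerve_map_on ?F)"
    unfolding nerve_map_on_def using tot by (intro continuous_intros w) auto
  then have "continuous_on ?N nerve_map"
    by (rule continuous_on_eq) (use sup fin in \<open>auto intro: nerve_map_on_eq\<close>)
  then show "\<exists>N. openin (top_of_set R) N \<and> t \<in> N \<and> continuous_on N nerve_map"
    using i by blast
qed

section \<open>Truncation at the level\<close>

definition truncate_on :: "'i set \<Rightarrow> ('i \<Rightarrow> real) \<Rightarrow> 'i \<Rightarrow> real" where
  "truncate_on F t v = max 0 (t v - level F t) / (\<Sum>v\<in>F. max 0 (t v - level F t))"

definition truncate :: "('i \<Rightarrow> real) \<Rightarrow> 'i \<Rightarrow> real" where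
  "truncate t = truncate_on (support t) t"

lemma sum_truncate_pos:
  assumes "t \<in> R" "finite F" "support t \<subseteq> F"
  shows "0 < (\<Sum>v\<in>F. max 0 (t v - level F t))"
proof -
  obtain v where "v \<in> support t" "level (support t) t < t v"
    using level_less[OF assms(1)] .
  then show ?thesis
    using assms level_mono_neutral[OF assms(2,3)] by (intro sum_pos2[of _ v]) auto
qed

lemma truncate_on_eq:
  assumes "t \<in> R" "finite F" "support t \<subseteq> F"
  shows "truncate_on F t = truncate t"
proof -
  have lev: "level F t = level (support t) t"
    by (rule level_mono_neutral[OF assms(2,3)])
  have "(\<Sum>v\<in>F. max 0 (t v - level F t)) = (\<Sum>v\<in>support t. max 0 (t v - level F t))"
    using assms level_pos[OF assms(1)] lev
    by (intro sum.mono_neutral_right) (auto simp: support_def)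
  then show ?thesis
    by (auto simp: truncate_def truncate_on_def lev)
qed

lemma truncate_eq_0: "t \<in> R \<Longrightarrow> t v \<le> level (support t) t \<Longrightarrow> truncate t v = 0"
  by (simp add: truncate_def truncate_on_def)

text \<open>Only vertices strictly above the level survive. The freedom in \<sigma> is used twice:
  for \<open>support t\<close>, and for the indices of the sets that contain
  \<open>nerve_map t\<close>.\<close>

lemma truncate_in_simplex:
  assumes t: "t \<in> R" and \<sigma>: "finite \<sigma>" "\<And>v. level (support t) t < t v \<Longrightarrow> v \<in> \<sigma>"
  shows "truncate t \<in> geom_simplex \<sigma>"
proof -
  let ?S = "support t"
  let ?m = "\<lambda>v. max 0 (t v - level ?S t)"
  have fin: "finite ?S"
    using realizationD(1)[OF t] by (auto simp: nerve_def)
  have pos: "0 < sum ?m ?S"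
    using sum_truncate_pos[OF t fin] by simp
  have small: "?m v = 0" if "v \<notin> \<sigma>" for v
    using \<sigma>(2)[of v] that by force
  \<comment> \<open>\<sigma> and the support need not be comparable, so both sums are compared with
    the sum over their union.\<close>
  have "sum ?m \<sigma> = sum ?m (\<sigma> \<union> ?S)"
    using \<sigma>(1) fin small by (intro sum.mono_neutral_left) auto
  also have "\<dots> = sum ?m ?S"
    using \<sigma>(1) fin level_pos[OF t] by (intro sum.mono_neutral_right) (auto simp: support_def)
  finally have "sum (truncate t) \<sigma> = 1"
    using pos by (simp add: truncate_def truncate_on_def flip: sum_divide_distrib)
  moreover have "truncate t v = 0" if "v \<notin> \<sigma>" for v
    using \<sigma>(2)[of v] that by (intro truncate_eq_0 t) force
  moreover have "0 \<le> truncate t v" for v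
    using pos by (simp add: truncate_def truncate_on_def)
  ultimately show ?thesis
    by (simp add: geom_simplex_def)
qed

lemma continuous_on_truncate: "continuous_on R truncate"
proof (rule continuous_on_locally)
  fix t assume t: "t \<in> R"
  obtain i where i: "i \<in> I" "openin (top_of_set R) {s\<in>R. s i \<noteq> 0}" "t \<in> {s\<in>R. s i \<noteq> 0}"
    and sup: "\<And>s. s \<in> R \<Longrightarrow> s i \<noteq> 0 \<Longrightarrow> support s \<subseteq> neighbours i"
    by (rule realization_star_nhd[OF t]) blast
  let ?N = "{s\<in>R. s i \<noteq> 0}" and ?F = "neighbours i"
  have fin: "finite ?F"
    using finite_neighbours[OF i(1)] .
  have "(\<Sum>v\<in>?F. max 0 (s v - level ?F s)) \<noteq> 0" if "s \<in> ?N" for s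
    using sum_truncate_pos[OF _ fin sup, of s] that by simp
  then have "continuous_on ?N (truncate_on ?F)"
    unfolding truncate_on_def
    by (intro continuous_intros continuous_on_coordinate continuous_on_level) auto
  then have "continuous_on ?N truncate"
    by (rule continuous_on_eq) (use sup fin in \<open>auto intro: truncate_on_eq\<close>)
  then show "\<exists>N. openin (top_of_set R) N \<and> t \<in> N \<and> continuous_on N truncate"
    using i by blast
qed

section \<open>The map from the union to the realization\<close>

lemma nerve_of_point:
  assumes "y \<in> U"
  shows "{i\<in>I. y \<in> B i} \<in> K"
proof -
  obtain i where i: "i \<in> I" "y \<in> B i"
    using assms by blast
  have "finite {i\<in>I. y \<in> B i}"
    using i by (intro finite_subset[OF _ finite_neighbours[OF i(1)]]) (auto simp: neighbours_def)
  then show ?thesis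
    using i by (auto simp: nerve_def)
qed

lemma nerve_partition_of_unity:
  obtains f where "continuous_on U f"
    "\<And>y. y \<in> U \<Longrightarrow> f y \<in> geom_simplex {i\<in>I. y \<in> B i}"
proof -
  \<comment> \<open>\<open>infdist\<close> to the empty set is 0 by convention, so
    \<open>B i = UNIV\<close> needs the separate value 1.\<close>
  define \<phi> where "\<phi> i y = (if i \<in> I then if B i = UNIV then 1 else infdist y (- B i) else 0)" for i y
  have nonneg: "0 \<le> \<phi> i y" for i y
    by (auto simp: \<phi>_def infdist_nonneg)
  have pos: "\<phi> i y \<noteq> 0 \<longleftrightarrow> i \<in> I \<and> y \<in> B i" for i y
  proof (cases "i \<in> I \<and> B i \<noteq> UNIV")
    case True
    then have "y \<in> - B i \<longleftrightarrow> infdist y (- B i) = 0"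
      using B(1) by (intro in_closed_iff_infdist_zero) auto
    then show ?thesis
      using True by (auto simp: \<phi>_def)
  qed (auto simp: \<phi>_def)
  have cont: "continuous_on S (\<phi> i)" for S i
    unfolding \<phi>_def by (cases "i \<in> I"; cases "B i = UNIV") (auto intro!: continuous_intros)
  define T where "T y = (\<Sum>i\<in>{i\<in>I. y \<in> B i}. \<phi> i y)" for y
  define f where "f y i = \<phi> i y / T y" for y i
  have Tpos: "0 < T y" if "y \<in> U" for y
    unfolding T_def using nerve_of_point[OF that] nonneg pos
    by (intro sum_pos) (auto simp: nerve_def less_le)
  have "f y \<in> geom_simplex {i\<in>I. y \<in> B i}" if "y \<in> U" for y
  proof -
    have "sum (f y) {i\<in>I. y \<in> B i} = T y / T y"
      unfolding f_def T_def by (rule sum_divide_distrib[symmetric])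
    then show ?thesis
      using Tpos[OF that] nonneg pos unfolding geom_simplex_def f_def by auto
  qed
  moreover have "continuous_on U f"
  proof (rule continuous_on_open_UN)
    fix i assume i: "i \<in> I"
    \<comment> \<open>On \<open>B i\<close> only neighbours of \<open>i\<close> contribute, which
      makes the index set independent of \<open>y\<close>.\<close>
    have T: "T y = (\<Sum>j\<in>neighbours i. \<phi> j y)" if "y \<in> B i" for y
      unfolding T_def using that i finite_neighbours[OF i] pos
      by (intro sum.mono_neutral_left) (auto simp: neighbours_def)
    have "(\<Sum>j\<in>neighbours i. \<phi> j y) \<noteq> 0" if "y \<in> B i" for y
      using Tpos[of y] T[OF that] UN_I[of i I y B, OF i that] by simp
    then have "continuous_on (B i) (\<lambda>y v. \<phi> v y / (\<Sum>j\<in>neighbours i. \<phi> j y))"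
      by (intro continuous_intros cont) auto
    then show "continuous_on (B i) f"
      by (rule continuous_on_eq) (auto simp: f_def T)
  qed (rule B(1))
  ultimately show thesis
    using that by blast
qed

text \<open>Nothing places \<open>t\<close> and \<open>f (nerve_map t)\<close> in a common simplex,
  but \<open>truncate t\<close> shares one with each, so two linear homotopies are chained.\<close>

theorem nerve_theorem: "top_of_set U homotopy_equivalent_space geom_realization K"
proof -
  obtain f where f: "continuous_on U f" "\<And>y. y \<in> U \<Longrightarrow> f y \<in> geom_simplex {i\<in>I. y \<in> B i}"
    by (rule nerve_partition_of_unity) blast
  have fR: "f y \<in> R" if "y \<in> U" for y
    using f(2)[OF that] nerve_of_point[OF that] by blast
  have nerve_map_U: "nerve_map t \<in> U" if t: "t \<in> R" for t
    using level_less[OF t] nerve_map_in[OF t] realizationD(1)[OF t]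
    by (smt (verit) UN_iff mem_Collect_eq nerve_def subsetD)
  have cf: "continuous_map (top_of_set U) (top_of_set R) f"
    using f(1) fR by auto
  have cs: "continuous_map (top_of_set R) (top_of_set U) nerve_map"
    using continuous_on_nerve_map nerve_map_U by auto
  have "homotopic_with_canon (\<lambda>_. True) U U (nerve_map \<circ> f) id"
  proof (rule homotopic_with_linear)
    show "continuous_on U (nerve_map \<circ> f)"
      using continuous_map_compose[OF cf cs] by auto
    fix y assume y: "y \<in> U"
    \<comment> \<open>A vertex above the level of \<open>f y\<close> indexes a set that contains
      \<open>y\<close>, and \<open>nerve_map\<close> sends \<open>f y\<close> into the same convex
      set.\<close>
    obtain i where i: "i \<in> support (f y)" "level (support (f y)) (f y) < f y i"
      using level_less[OF fR[OF y]] .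
    then have "i \<in> I" "y \<in> B i"
      using f(2)[OF y] by (auto simp: geom_simplex_def support_def)
    moreover have "nerve_map (f y) \<in> B i"
      using i(2) by (intro nerve_map_in fR y) auto
    ultimately have "closed_segment (nerve_map (f y)) y \<subseteq> B i"
      using B(2) by (intro closed_segment_subset) auto
    then show "closed_segment ((nerve_map \<circ> f) y) (id y) \<subseteq> U"
      using \<open>i \<in> I\<close> by auto
  qed auto
  moreover have "homotopic_with_canon (\<lambda>_. True) R R id truncate"
  proof (rule homotopic_linear_in_simplices)
    fix t assume t: "t \<in> R"
    have "truncate t \<in> geom_simplex (support t)"
      using realizationD(1)[OF t] level_pos[OF t]
      by (intro truncate_in_simplex t) (auto simp: nerve_def support_def)
    then show "\<exists>\<sigma>\<in>K. id t \<in> geom_simplex \<sigma> \<and> truncate t \<in> geom_simplex \<sigma>"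
      using realizationD[OF t] by auto
  qed (auto intro: continuous_on_truncate)
  moreover have "homotopic_with_canon (\<lambda>_. True) R R truncate (f \<circ> nerve_map)"
  proof (rule homotopic_linear_in_simplices)
    show "continuous_on R (f \<circ> nerve_map)"
      using continuous_map_compose[OF cs cf] by auto
    fix t assume t: "t \<in> R"
    let ?\<sigma> = "{i\<in>I. nerve_map t \<in> B i}"
    have \<sigma>: "?\<sigma> \<in> K"
      by (rule nerve_of_point[OF nerve_map_U[OF t]])
    have "i \<in> ?\<sigma>" if i: "level (support t) t < t i" for i
    proof -
      have "i \<in> support t"
        using i level_pos[OF t] by (auto simp: support_def)
      then have "i \<in> I"
        using realizationD(1)[OF t] by (auto simp: nerve_def)
      then show ?thesis
        using nerve_map_in[OF t, of i] i by simp
    qed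
    then have "truncate t \<in> geom_simplex ?\<sigma>"
      using \<sigma> by (intro truncate_in_simplex t) (auto simp: nerve_def)
    then show "\<exists>\<sigma>\<in>K. truncate t \<in> geom_simplex \<sigma> \<and> (f \<circ> nerve_map) t \<in> geom_simplex \<sigma>"
      using \<sigma> f(2)[OF nerve_map_U[OF t]] by auto
  qed (rule continuous_on_truncate)
  ultimately show ?thesis
    unfolding geom_realization_nerve homotopy_equivalent_space_def
    using cf cs by (meson homotopic_with_symD homotopic_with_trans)
qed

end

section \<open>The ambient Cech complex\<close>

theorem theorem19:
  fixes X P :: "(real ^ 'n) set"
    and r :: "real ^ 'n \<Rightarrow> real"
    and \<tau> \<epsilon> \<delta> rmin rmax l \<epsilon>l r\<delta>c_sq rmin'' rb_sq r\<delta>b_sq :: real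
  assumes "X \<noteq> {}" and "closed X"
    and "reach X = ereal \<tau>" and "0 < \<tau>"
    and "closed P" and "discrete P"
    and "\<And>x. x \<in> P \<Longrightarrow> 0 < r x"
    and "rmin \<in> r ` P" and "\<And>x. x \<in> P \<Longrightarrow> rmin \<le> r x"
    and "rmax \<in> r ` P" and "\<And>x. x \<in> P \<Longrightarrow> r x \<le> rmax"
    and "\<epsilon> \<in> (\<lambda>x. infdist x X) ` P" and "\<And>x. x \<in> P \<Longrightarrow> infdist x X \<le> \<epsilon>"
    and "0 < \<delta>"
    and "X \<subseteq> (\<Union>x\<in>P. ball x \<delta>)"
    and "rmax \<le> \<tau> - \<epsilon>"
    and "l = 1/2 * (rmin - \<tau> + sqrt ((\<tau> - \<epsilon>)^2 - rmax^2) - \<delta>)"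
    and "\<epsilon>l = \<tau> - sqrt ((\<tau> - \<epsilon>)^2 - rmax^2) + l"
    and "r\<delta>c_sq = min (\<delta>^2 + \<epsilon> * (2*\<tau> - \<epsilon>))
           (1/2 * (rmax^2 - l^2 + \<epsilon> * (2*\<tau> - \<epsilon>) + \<epsilon>l * (2*\<tau> - \<epsilon>l)))"
    and "rmin'' = sqrt (\<tau>^2 - \<epsilon> * (2*\<tau> - \<epsilon>)
           - (2*\<tau>^2 - rmin^2 - \<epsilon> * (2*\<tau> - \<epsilon>))^2 / (4*\<tau>^2))"
    and "rb_sq = 2*\<tau> * (rmin''^2 + \<epsilon> * (2*\<tau> - \<epsilon>))
           / (\<tau> + sqrt (\<tau>^2 - (rmin''^2 + \<epsilon> * (2*\<tau> - \<epsilon>))))"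
    and "r\<delta>b_sq = min (\<delta>^2 + \<epsilon> * (2*\<tau> - \<epsilon>)) (1/2 * rb_sq)"
    \<comment> \<open>well-definedness of the square roots and denominators\<close>
    and "0 \<le> (\<tau> - \<epsilon>)^2 - rmax^2"
    and "0 < \<tau>^2 - r\<delta>c_sq"
    and "0 \<le> rmax^2 - l^2 + \<epsilon> * (2*\<tau> - \<epsilon>)
           - ((\<tau> - \<epsilon>)^2 - rmax^2 + l^2 + (\<tau> - \<epsilon>l)^2) * (\<tau> / sqrt (\<tau>^2 - r\<delta>c_sq) - 1)"
    and "0 \<le> \<tau>^2 - \<epsilon> * (2*\<tau> - \<epsilon>)
           - (2*\<tau>^2 - rmin^2 - \<epsilon> * (2*\<tau> - \<epsilon>))^2 / (4*\<tau>^2)"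
    and "0 \<le> \<tau>^2 - (rmin''^2 + \<epsilon> * (2*\<tau> - \<epsilon>))"
    and "0 < \<tau>^2 - r\<delta>b_sq"
    and "0 \<le> rb_sq - (2*\<tau>^2 - rb_sq) * (\<tau> / sqrt (\<tau>^2 - r\<delta>b_sq) - 1)"
    \<comment> \<open>the two conditions on \<open>\<delta>\<close>\<close>
    and "\<delta> + sqrt (rmax^2 - l^2 + \<epsilon> * (2*\<tau> - \<epsilon>)
           - ((\<tau> - \<epsilon>)^2 - rmax^2 + l^2 + (\<tau> - \<epsilon>l)^2) * (\<tau> / sqrt (\<tau>^2 - r\<delta>c_sq) - 1))
         \<le> rmin"
    and "sqrt (real CARD('n) / (2 * (real CARD('n) + 1))) * (rmax / rmin)
         * (sqrt (rb_sq - (2*\<tau>^2 - rb_sq) * (\<tau> / sqrt (\<tau>^2 - r\<delta>b_sq) - 1)) + 2*\<delta>)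
         \<le> rmin''"
  shows "top_of_set X homotopy_equivalent_space geom_realization (cech_complex P r)"
proof -
  note radius = assms(7,9,11) and \<epsilon> = assms(13)
  define a where "a = sqrt ((\<tau> - \<epsilon>)\<^sup>2 - rmax\<^sup>2)"
  define A where "A = rmax\<^sup>2 - l\<^sup>2 + \<epsilon> * (2 * \<tau> - \<epsilon>)
    - ((\<tau> - \<epsilon>)\<^sup>2 - rmax\<^sup>2 + l\<^sup>2 + (\<tau> - \<epsilon>l)\<^sup>2) * (\<tau> / sqrt (\<tau>\<^sup>2 - r\<delta>c_sq) - 1)"
  have a: "0 \<le> a" "(\<tau> - \<epsilon>)\<^sup>2 - rmax\<^sup>2 = a\<^sup>2"
    using assms(23) by (auto simp: a_def)
  have l: "2 * l = rmin - \<tau> + a - \<delta>" and \<epsilon>l: "\<epsilon>l = \<tau> - a + l"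
    using assms(17,18) by (auto simp: a_def)
  \<comment> \<open>From \<open>(\<tau> - \<epsilon>)\<^sup>2 = \<tau>\<^sup>2 - \<epsilon> * (2 *
    \<tau> - \<epsilon>)\<close>: here \<epsilon> and \<open>rmax\<close> enter only through
    \<open>a\<close>.\<close>
  have radicand: "rmax\<^sup>2 - l\<^sup>2 + \<epsilon> * (2 * \<tau> - \<epsilon>) = \<tau>\<^sup>2 - a\<^sup>2 - l\<^sup>2"
    using a(2) by (simp add: power2_eq_square algebra_simps)
  have sqrt_le: "\<delta> + sqrt A \<le> rmin" and A0: "0 \<le> A"
    using assms(25,30) by (simp_all add: A_def)
  have "0 \<le> l"
  proof (rule sampling_condition_imp_gap_nonneg[OF assms(4) a(1) _ _ A0])
    have "r\<delta>c_sq \<le> 1/2 * (rmax\<^sup>2 - l\<^sup>2 + \<epsilon> * (2*\<tau> - \<epsilon>) + \<epsilon>l * (2*\<tau> - \<epsilon>l))"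
      unfolding assms(19) by (rule min.cobounded2)
    \<comment> \<open>Likewise \<open>\<epsilon>l * (2 * \<tau> - \<epsilon>l) = \<tau>\<^sup>2 - (a
      - l)\<^sup>2\<close>, because \<open>\<tau> - \<epsilon>l = a - l\<close>.\<close>
    also have "\<dots> = (2 * \<tau>\<^sup>2 - a\<^sup>2 - l\<^sup>2 - (a - l)\<^sup>2) / 2"
      unfolding radicand \<epsilon>l by (simp add: power2_eq_square algebra_simps)
    finally show "r\<delta>c_sq \<le> (2 * \<tau>\<^sup>2 - a\<^sup>2 - l\<^sup>2 - (a - l)\<^sup>2) / 2" .
    show "A = \<tau>\<^sup>2 - a\<^sup>2 - l\<^sup>2 - (a\<^sup>2 + l\<^sup>2 + (a - l)\<^sup>2) * (\<tau> / sqrt (\<tau>\<^sup>2 - r\<delta>c_sq) - 1)"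
      unfolding A_def radicand a(2) \<epsilon>l by simp
    show "sqrt A \<le> \<tau> - a + 2 * l"
      using sqrt_le l by linarith
  qed
  then have gap: "\<delta> + \<tau> - sqrt ((\<tau> - \<epsilon>)\<^sup>2 - rmax\<^sup>2) \<le> rmin"
    using l by (simp add: a_def)
  have "\<delta> \<le> rmin"
    using sqrt_le real_sqrt_ge_zero[OF A0] by linarith
  then have "top_of_set X homotopy_equivalent_space top_of_set (\<Union>x\<in>P. ball x (r x))"
    using assms(3)
    by (intro union_of_balls_homotopy_equivalent[OF assms(1,2) _ radius(2,1,3) \<epsilon> assms(15) _ assms(16) gap]) auto
  moreover have "top_of_set (\<Union>x\<in>P. ball x (r x)) homotopy_equivalent_space geom_realization (cech_complex P r)"
    unfolding cech_complex_eq_nerve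
  proof (rule nerve_theorem)
    fix x assume x: "x \<in> P"
    \<comment> \<open>Balls that meet have centres within \<open>2 * rmax\<close>, and a closed
      discrete set has finitely many points in a compact ball.\<close>
    have "{y\<in>P. ball x (r x) \<inter> ball y (r y) \<noteq> {}} \<subseteq> P \<inter> cball x (2 * rmax)"
    proof
      fix y assume y: "y \<in> {y\<in>P. ball x (r x) \<inter> ball y (r y) \<noteq> {}}"
      then obtain z where "dist x z < r x" "dist y z < r y"
        by auto
      then have "dist x y \<le> 2 * rmax"
        using dist_triangle[of x y z] radius(3)[OF x] radius(3)[of y] y by (simp add: dist_commute)
      then show "y \<in> P \<inter> cball x (2 * rmax)"
        using y by simp
    qed
    moreover have "finite (P \<inter> cball x (2 * rmax))"
      using assms(5,6) discrete_subset[of P "P \<inter> cball x (2 * rmax)"]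
      by (simp add: closed_Int_compact flip: discrete_compact_finite_iff)
    ultimately show "finite {y\<in>P. ball x (r x) \<inter> ball y (r y) \<noteq> {}}"
      by (rule finite_subset)
  qed auto
  ultimately show ?thesis
    by (rule homotopy_eqv_trans)
qed

end
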